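(* Let $\lambda,\mu,\theta>0$ and let $m\ge 1$ be an integer. Let $p_i^{\mathrm{DBS},\mu}(\lambda)$ and $p_i^{\mathrm{DES},\mu}(\lambda)$ denote the steady-state probabilities that there are $i$ jobs in system in an M/M/$m+$M queue with arrival rate $\lambda$, server rate $\mu$ and abandonment rate $\theta$ under DBS and under DES, respectively. Then, for $i=0,1,\ldots$, $$p_i^{\mathrm{DES},\mu}(\lambda)=p_i^{\mathrm{DBS},\mu+\theta}(\lambda).$$
   Context: M/M/$m+$M queue: jobs arrive as a Poisson process of rate $\lambda$ to a node with $m$ identical servers, an unlimited buffer, FCFS scheduling, and independent exponential service times of rate $\mu$; each job has an independent exponential relative deadline (time from arrival to deadline expiration) with rate $\theta$, and abandons the system immediately upon missing it. Under DBS (deadline to the beginning of service) a job abandons if its deadline expires before its service starts; under DES (deadline to the end of service) it abandons if its deadline expires before its service ends. Thus the number of jobs in system is a birth-death process on $\{0,1,2,\ldots\}$ with birth rate $\lambda$ and death rate in state $i$ equal to $\min(i,m)\mu+(i-m)^+\theta$ under DBS and $\min(i,m)\mu+i\theta$ under DES, where $x^+=\max(x,0)$. The superscript $\mu+\theta$ refers to the same queue with server rate $\mu$ replaced by $\mu+\theta$ ($m$ and $\theta$ unchanged). *)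

theory Defs
  imports "HOL-Probability.Probability"
begin

text \<open>
  Birth-death processes on \<open>{0, 1, 2, \<dots>}\<close>, given by birth rates \<open>b i\<close> and death
  rates \<open>d i\<close>. There is no death in state \<open>0\<close>, whatever the value of \<open>d 0\<close>.
\<close>

definition bd_generator :: "(nat \<Rightarrow> real) \<Rightarrow> (nat \<Rightarrow> real) \<Rightarrow> nat \<Rightarrow> nat \<Rightarrow> real" where
  "bd_generator b d i j =
     (if j = Suc i then b i
      else if i = Suc j then d i
      else if i = j then - (b i + (if i = 0 then 0 else d i))
      else 0)"

text \<open>
  A steady-state distribution is a probability distribution \<open>p\<close> solving the global balance
  equations \<open>p Q = 0\<close>. The definite description below is well defined for the two queues
  considered; see \<open>steady_state_DBS\<close> and \<open>steady_state_DES\<close>.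
\<close>

definition stationary :: "(nat \<Rightarrow> nat \<Rightarrow> real) \<Rightarrow> nat pmf \<Rightarrow> bool" where
  "stationary Q p \<longleftrightarrow> (\<forall>j. ((\<lambda>i. pmf p i * Q i j) has_sum 0) UNIV)"

definition steady_state :: "(nat \<Rightarrow> nat \<Rightarrow> real) \<Rightarrow> nat pmf" where
  "steady_state Q = (THE p. stationary Q p)"

text \<open>
  Death rates of the M/M/$m$+M queue: service completions plus abandonments. Under DBS only the
  waiting jobs can abandon, under DES all jobs in system can.
\<close>

definition death_DBS :: "nat \<Rightarrow> real \<Rightarrow> real \<Rightarrow> nat \<Rightarrow> real" where
  "death_DBS m \<theta> \<mu> i = real (min i m) * \<mu> + max (real i - real m) 0 * \<theta>"

definition death_DES :: "nat \<Rightarrow> real \<Rightarrow> real \<Rightarrow> nat \<Rightarrow> real" where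
  "death_DES m \<theta> \<mu> i = real (min i m) * \<mu> + real i * \<theta>"

definition Q_DBS :: "nat \<Rightarrow> real \<Rightarrow> real \<Rightarrow> real \<Rightarrow> nat \<Rightarrow> nat \<Rightarrow> real" where
  "Q_DBS m \<theta> \<mu> lam = bd_generator (\<lambda>_. lam) (death_DBS m \<theta> \<mu>)"

definition Q_DES :: "nat \<Rightarrow> real \<Rightarrow> real \<Rightarrow> real \<Rightarrow> nat \<Rightarrow> nat \<Rightarrow> real" where
  "Q_DES m \<theta> \<mu> lam = bd_generator (\<lambda>_. lam) (death_DES m \<theta> \<mu>)"

definition p_DBS :: "nat \<Rightarrow> real \<Rightarrow> real \<Rightarrow> real \<Rightarrow> nat \<Rightarrow> real" where
  "p_DBS m \<theta> \<mu> lam i = pmf (steady_state (Q_DBS m \<theta> \<mu> lam)) i"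

definition p_DES :: "nat \<Rightarrow> real \<Rightarrow> real \<Rightarrow> real \<Rightarrow> nat \<Rightarrow> real" where
  "p_DES m \<theta> \<mu> lam i = pmf (steady_state (Q_DES m \<theta> \<mu> lam)) i"


subsection \<open>Existence and uniqueness of the steady state\<close>

lemma bd_column_0:
  "((\<lambda>i. x i * bd_generator b d i 0) has_sum (x 1 * d 1 - x 0 * b 0)) UNIV"
  by (rule has_sum_finite_neutralI[where B = "{0, 1}"]) (auto simp: bd_generator_def)

lemma bd_column_Suc:
  "((\<lambda>i. x i * bd_generator b d i (Suc k)) has_sum
      (x k * b k - x (Suc k) * (b (Suc k) + d (Suc k)) + x (Suc (Suc k)) * d (Suc (Suc k)))) UNIV"
  by (rule has_sum_finite_neutralI[where B = "{k, Suc k, Suc (Suc k)}"])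
     (auto simp: bd_generator_def algebra_simps)

lemma stationary_bd_iff:
  "stationary (bd_generator b d) p \<longleftrightarrow>
     (\<forall>i. pmf p (Suc i) * d (Suc i) = pmf p i * b i)"
proof
  assume s: "stationary (bd_generator b d) p"
  have "pmf p 1 * d 1 - pmf p 0 * b 0 = 0"
    using s[unfolded stationary_def, rule_format, of 0] bd_column_0[of "pmf p" b d]
    by (metis has_sum_unique)
  moreover have "pmf p k * b k - pmf p (Suc k) * (b (Suc k) + d (Suc k))
      + pmf p (Suc (Suc k)) * d (Suc (Suc k)) = 0" for k
    using s[unfolded stationary_def, rule_format, of "Suc k"] bd_column_Suc[of "pmf p" b d k]
    by (metis has_sum_unique)
  ultimately have "pmf p (Suc i) * d (Suc i) = pmf p i * b i" for i
  proof (induction i)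
    case (Suc i)
    from Suc.IH[OF Suc.prems] Suc.prems(2)[of i] show ?case by (simp add: algebra_simps)
  qed simp
  then show "\<forall>i. pmf p (Suc i) * d (Suc i) = pmf p i * b i" by blast
next
  assume e: "\<forall>i. pmf p (Suc i) * d (Suc i) = pmf p i * b i"
  have "((\<lambda>i. pmf p i * bd_generator b d i j) has_sum 0) UNIV" for j
  proof (cases j)
    case 0
    then show ?thesis
      using bd_column_0[of "pmf p" b d] e[rule_format, of 0] by simp
  next
    case (Suc k)
    then show ?thesis
      using bd_column_Suc[of "pmf p" b d k] e[rule_format, of k] e[rule_format, of "Suc k"]
      by (simp add: algebra_simps)
  qed
  then show "stationary (bd_generator b d) p" by (simp add: stationary_def)
qed

lemma ex1_stationary:
  fixes lam c :: real
  assumes lam: "lam > 0" and c: "c > 0" and d: "\<And>i. d i \<ge> c * real i"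
  shows "\<exists>!p. stationary (bd_generator (\<lambda>_. lam) d) p"
proof -
  have dpos: "d (Suc i) > 0" for i
    using d[of "Suc i"] c by (smt (verit) mult_pos_pos of_nat_0_less_iff zero_less_Suc)
  define w where "w i = (\<Prod>k<i. lam / d (Suc k))" for i
  have wS: "w (Suc i) * d (Suc i) = w i * lam" for i
    using dpos[of i] by (simp add: w_def)
  have wpos: "w i > 0" for i
    unfolding w_def using lam dpos by (intro prod_pos) auto
  have w_le: "w i \<le> (lam / c) ^ i /\<^sub>R fact i" for i
  proof (induction i)
    case (Suc i)
    have "w (Suc i) = w i * (lam / d (Suc i))" by (simp add: w_def)
    also have "\<dots> \<le> ((lam / c) ^ i /\<^sub>R fact i) * (lam / (c * real (Suc i)))"
      using Suc d[of "Suc i"] lam c dpos[of i] wpos[of i]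
      by (intro mult_mono divide_left_mono) (auto intro!: mult_pos_pos)
    also have "\<dots> = (lam / c) ^ Suc i /\<^sub>R fact (Suc i)"
      using c by (simp add: field_simps)
    finally show ?case .
  qed (simp add: w_def)
  have summ: "summable w"
    by (rule summable_comparison_test'[OF summable_exp_generic[of "lam / c"], of 0])
       (use w_le wpos in \<open>auto simp: less_imp_le\<close>)
  define S where "S = suminf w"
  have S: "S > 0"
    unfolding S_def using suminf_pos[OF summ] wpos by simp
  have sums1: "(\<lambda>i. w i / S) sums 1"
    using sums_divide[OF summable_sums[OF summ], of S] S by (simp add: S_def)
  have nn: "w i / S \<ge> 0" for i using wpos[of i] S by (simp add: less_imp_le)
  have "(\<integral>\<^sup>+ i. ennreal (w i / S) \<partial>count_space UNIV) = (\<Sum>i. ennreal (w i / S))"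
    by (rule nn_integral_count_space_nat)
  also have "\<dots> = 1"
    using suminf_ennreal_eq[OF nn sums1] by simp
  finally have int1: "(\<integral>\<^sup>+ i. ennreal (w i / S) \<partial>count_space UNIV) = 1" .
  have ex: "stationary (bd_generator (\<lambda>_. lam) d) (embed_pmf (\<lambda>i. w i / S))"
    using wS S by (simp add: stationary_bd_iff pmf_embed_pmf[OF nn int1])
  have form: "pmf p i = pmf p 0 * w i" if "stationary (bd_generator (\<lambda>_. lam) d) p" for p i
  proof (induction i)
    case (Suc i)
    have "pmf p (Suc i) * d (Suc i) = pmf p 0 * w (Suc i) * d (Suc i)"
      using that Suc wS[of i] by (simp add: stationary_bd_iff algebra_simps)
    then show ?case using dpos[of i] by simp
  qed (simp add: w_def)
  have le: "\<not> pmf p 0 < pmf q 0"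
    if p: "stationary (bd_generator (\<lambda>_. lam) d) p" and q: "stationary (bd_generator (\<lambda>_. lam) d) q"
    for p q
  proof
    assume less: "pmf p 0 < pmf q 0"
    then have "q \<noteq> p" by auto
    then obtain x where "pmf q x < pmf p x" using pmf_neq_exists_less by blast
    then show False
      using form[OF p, of x] form[OF q, of x] less wpos[of x] by simp
  qed
  show ?thesis
  proof (rule ex1I[where P = "stationary _", OF ex])
    fix p assume p: "stationary (bd_generator (\<lambda>_. lam) d) p"
    have "pmf p 0 = pmf (embed_pmf (\<lambda>i. w i / S)) 0"
      using le[OF p ex] le[OF ex p] by linarith
    then show "p = embed_pmf (\<lambda>i. w i / S)"
      by (intro pmf_eqI) (metis form[OF p] form[OF ex])
  qed
qed

lemma death_DBS_ge: "death_DBS m \<theta> \<mu> i \<ge> min \<mu> \<theta> * real i"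
proof -
  have "min \<mu> \<theta> * real i
      = real (min i m) * min \<mu> \<theta> + max (real i - real m) 0 * min \<mu> \<theta>"
    by (cases "i \<le> m") (auto simp: algebra_simps max_def)
  also have "\<dots> \<le> death_DBS m \<theta> \<mu> i"
    unfolding death_DBS_def by (intro add_mono mult_left_mono) auto
  finally show ?thesis .
qed

lemma ex1_stationary_DBS:
  "lam > 0 \<Longrightarrow> \<mu> > 0 \<Longrightarrow> \<theta> > 0 \<Longrightarrow> \<exists>!p. stationary (Q_DBS m \<theta> \<mu> lam) p"
  unfolding Q_DBS_def
  by (rule ex1_stationary[where c = "min \<mu> \<theta>"]) (auto simp: death_DBS_ge)

lemma ex1_stationary_DES:
  "lam > 0 \<Longrightarrow> \<mu> > 0 \<Longrightarrow> \<theta> > 0 \<Longrightarrow> \<exists>!p. stationary (Q_DES m \<theta> \<mu> lam) p"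
  unfolding Q_DES_def
  by (rule ex1_stationary[where c = \<theta>]) (auto simp: death_DES_def)

lemma steady_state_DBS:
  assumes "lam > 0" "\<mu> > 0" "\<theta> > 0"
  shows "stationary (Q_DBS m \<theta> \<mu> lam) p \<longleftrightarrow> p = steady_state (Q_DBS m \<theta> \<mu> lam)"
  unfolding steady_state_def
  using theI'[OF ex1_stationary_DBS[OF assms]] ex1_stationary_DBS[OF assms] by metis

lemma steady_state_DES:
  assumes "lam > 0" "\<mu> > 0" "\<theta> > 0"
  shows "stationary (Q_DES m \<theta> \<mu> lam) p \<longleftrightarrow> p = steady_state (Q_DES m \<theta> \<mu> lam)"
  unfolding steady_state_def
  using theI'[OF ex1_stationary_DES[OF assms]] ex1_stationary_DES[OF assms] by metis

end

theory Submission
  imports Defs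
begin

text \<open>Since i = min(i,m) + (i-m)^+, the DES abandonment rate i\<theta> splits into a part from
  jobs in service and a part from waiting jobs. The former acts like extra service rate \<theta> at
  each busy server; the latter is the DBS abandonment rate.\<close>

lemma death_DES_eq_death_DBS: "death_DES m \<theta> \<mu> = death_DBS m \<theta> (\<mu> + \<theta>)"
  by (rule ext) (auto simp: death_DES_def death_DBS_def min_def max_def algebra_simps)

theorem proposition4:
  fixes lam \<mu> \<theta> :: real and m :: nat
  assumes "lam > 0" and "\<mu> > 0" and "\<theta> > 0" and "m \<ge> 1"
  shows "\<forall>i::nat. p_DES m \<theta> \<mu> lam i = p_DBS m \<theta> (\<mu> + \<theta>) lam i"
  \<comment> \<open>Birth rates agree as well, so both sides unfold to \<open>steady_state\<close>
    of one and the same generator.\<close>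
  by (simp add: p_DES_def p_DBS_def Q_DES_def Q_DBS_def death_DES_eq_death_DBS)

end
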